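(* Let $\lambda>0$, and let $u=(1,0)\in\mathbb{R}^2$, $v=(\tfrac12,\tfrac{\sqrt3}{2})\in\mathbb{R}^2$. There exists a $c$-conjugate triple $f,g,h\in\mathcal{A}(\mathbb{R}^2)$ for which the set $$\Gamma=\big\{(x,y,z)\in(\mathbb{R}^2)^3\ \big|\ f(x)+g(y)+h(z)=x\cdot y+y\cdot z+z\cdot x\big\}$$ satisfies $$S(\Gamma)=\mathbb{R}^2\setminus\operatorname{int}\mathbf{H}_\lambda,$$ where $\mathbf{H}_\lambda$ is the convex hull of the six points $\pm2\lambda u$, $\pm2\lambda v$, $\pm2\lambda(v-u)$. Furthermore, $\Gamma$ is not maximally $c$-monotone.
   Context: $\mathcal{A}(\mathbb{R}^2)$ denotes the set of proper, lower-semicontinuous, convex functions $\mathbb{R}^2\to\mathbb{R}\cup\{+\infty\}$. Here $c(x,y,z)=x\cdot y+y\cdot z+z\cdot x$ on $(\mathbb{R}^2)^3$. For proper functions $\varphi,\psi$ on $\mathbb{R}^2$, $(\varphi\oplus\psi)^c(z):=\sup_{x,y\in\mathbb{R}^2}\big(c(x,y,z)-\varphi(x)-\psi(y)\big)$. The triple $(f,g,h)$ is $c$-conjugate if $f=(g\oplus h)^c$, $g=(h\oplus f)^c$ and $h=(f\oplus g)^c$. $S(\Gamma)=\{x+y+z\mid(x,y,z)\in\Gamma\}$, and $\operatorname{int}$ denotes the interior. A set $\Gamma\subseteq(\mathbb{R}^2)^3$ is $c$-monotone if for all pairs $(x_1^1,x_2^1,x_3^1),(x_1^2,x_2^2,x_3^2)\in\Gamma$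 and all permutations $\sigma_1,\sigma_2,\sigma_3$ of $\{1,2\}$, $$\sum_{j=1}^2 c\big(x_1^{\sigma_1(j)},x_2^{\sigma_2(j)},x_3^{\sigma_3(j)}\big)\le\sum_{j=1}^2 c(x_1^j,x_2^j,x_3^j).$$ $\Gamma$ is maximally $c$-monotone if it is $c$-monotone and has no proper $c$-monotone extension (i.e. no $c$-monotone set strictly contains it). *)

theory Defs
  imports "HOL-Analysis.Analysis"
begin

type_synonym plane = "real ^ 2"

definition proper :: "(plane \<Rightarrow> ereal) \<Rightarrow> bool" where
  "proper f \<longleftrightarrow> (\<forall>x. f x \<noteq> -\<infinity>) \<and> (\<exists>x. f x \<noteq> \<infinity>)"

definition lsc :: "(plane \<Rightarrow> ereal) \<Rightarrow> bool" where
  "lsc f \<longleftrightarrow> (\<forall>x. f x \<le> Liminf (at x) f)"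

definition ereal_convex :: "(plane \<Rightarrow> ereal) \<Rightarrow> bool" where
  "ereal_convex f \<longleftrightarrow>
     (\<forall>x y t. 0 < t \<and> t < 1 \<longrightarrow>
        f ((1 - t) *\<^sub>R x + t *\<^sub>R y) \<le> ereal (1 - t) * f x + ereal t * f y)"

definition \<A> :: "(plane \<Rightarrow> ereal) set" where
  "\<A> = {f. proper f \<and> lsc f \<and> ereal_convex f}"

definition cost :: "plane \<Rightarrow> plane \<Rightarrow> plane \<Rightarrow> real" where
  "cost x y z = x \<bullet> y + y \<bullet> z + z \<bullet> x"

(* (\<phi> \<oplus> \<psi>)^c; only meaningful for proper \<phi> and \<psi>, so that no \<infinity> - \<infinity> arises. *)
definition c_conj :: "(plane \<Rightarrow> ereal) \<Rightarrow> (plane \<Rightarrow> ereal) \<Rightarrow> plane \<Rightarrow> ereal" where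
  "c_conj \<phi> \<psi> z = (SUP (x, y) \<in> UNIV. ereal (cost x y z) - \<phi> x - \<psi> y)"

definition c_conjugate_triple ::
    "(plane \<Rightarrow> ereal) \<Rightarrow> (plane \<Rightarrow> ereal) \<Rightarrow> (plane \<Rightarrow> ereal) \<Rightarrow> bool" where
  "c_conjugate_triple f g h \<longleftrightarrow> f = c_conj g h \<and> g = c_conj h f \<and> h = c_conj f g"

definition contact_set ::
    "(plane \<Rightarrow> ereal) \<Rightarrow> (plane \<Rightarrow> ereal) \<Rightarrow> (plane \<Rightarrow> ereal) \<Rightarrow> (plane \<times> plane \<times> plane) set" where
  "contact_set f g h = {(x, y, z). f x + g y + h z = ereal (x \<bullet> y + y \<bullet> z + z \<bullet> x)}"

definition sum_set :: "(plane \<times> plane \<times> plane) set \<Rightarrow> plane set" where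
  "sum_set \<Gamma> = {x + y + z | x y z. (x, y, z) \<in> \<Gamma>}"

(* The two points of \<Gamma> are (x1 j, x2 j, x3 j) for j = 1, 2. *)
definition c_monotone :: "(plane \<times> plane \<times> plane) set \<Rightarrow> bool" where
  "c_monotone \<Gamma> \<longleftrightarrow>
     (\<forall>(x1 :: nat \<Rightarrow> plane) x2 x3. (\<forall>j\<in>{1, 2}. (x1 j, x2 j, x3 j) \<in> \<Gamma>) \<longrightarrow>
        (\<forall>\<sigma>1 \<sigma>2 \<sigma>3. \<sigma>1 permutes {1, 2} \<and> \<sigma>2 permutes {1, 2} \<and> \<sigma>3 permutes {1, 2} \<longrightarrow>
           (\<Sum>j\<in>{1, 2}. cost (x1 (\<sigma>1 j)) (x2 (\<sigma>2 j)) (x3 (\<sigma>3 j)))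
             \<le> (\<Sum>j\<in>{1, 2}. cost (x1 j) (x2 j) (x3 j))))"

definition maximally_c_monotone :: "(plane \<times> plane \<times> plane) set \<Rightarrow> bool" where
  "maximally_c_monotone \<Gamma> \<longleftrightarrow> c_monotone \<Gamma> \<and> \<not> (\<exists>\<Gamma>'. c_monotone \<Gamma>' \<and> \<Gamma> \<subset> \<Gamma>')"

definition hexagon :: "plane \<Rightarrow> plane \<Rightarrow> real \<Rightarrow> plane set" where
  "hexagon u v lam = convex hull
     {(2 * lam) *\<^sub>R u, - ((2 * lam) *\<^sub>R u), (2 * lam) *\<^sub>R v, - ((2 * lam) *\<^sub>R v),
      (2 * lam) *\<^sub>R (v - u), - ((2 * lam) *\<^sub>R (v - u))}"

end

theory Submission
  imports Defs
begin

text \<open>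
  Let \<open>g\<close> and \<open>h\<close> be the convex indicators of the segments \<open>[-\<lambda>u, \<lambda>u]\<close> and \<open>[-\<lambda>v, \<lambda>v]\<close>, and let
  \<open>f\<close> be the \<open>c\<close>-conjugate of the pair \<open>g, h\<close>. Since \<open>u \<bullet> v = 1/2\<close>, the value \<open>f x\<close> is the maximum of
  \<open>b p + c q + b c / 2\<close> over the square \<open>\<bar>b\<bar>, \<bar>c\<bar> \<le> \<lambda>\<close>, where \<open>p = x \<bullet> u\<close> and \<open>q = x \<bullet> v\<close>. This expression
  is affine in \<open>b\<close> and in \<open>c\<close>, so the maximum is attained at a corner (\<open>bilinear_le_corner\<close>) and \<open>f\<close> is a
  finite piecewise linear function. Conjugating back gives \<open>g\<close> and \<open>h\<close> again
  (\<open>c_conj_corner_max\<close>): the value is \<open>0\<close> on the segment because \<open>f\<close> is balanced between two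
  corners at suitable points, and \<open>\<infinity>\<close> off the segment because \<open>f\<close> grows too slowly.

  A contact point is thus a triple \<open>(x, bu, cv)\<close> for which \<open>(b, c)\<close> maximises the above expression over
  the square. Written in terms of the sum \<open>s = x + bu + cv\<close>, with \<open>S = s \<bullet> u\<close> and \<open>T = s \<bullet> v\<close>, moving
  from \<open>(b, c)\<close> to \<open>(b', c')\<close> changes it by
  \<open>(b' - b)(S - b) + (c' - c)(T - c) + (b' - b)(c' - c)/2\<close>. Maximality in each variable alone forces
  \<open>b\<close> and \<open>c\<close> to be the projections of \<open>S\<close> and \<open>T\<close> to \<open>[-\<lambda>, \<lambda>]\<close>. These projections are a joint maximum
  exactly if one of \<open>\<bar>S + T\<bar>\<close>, \<open>\<bar>2S - T\<bar>\<close>, \<open>\<bar>2T - S\<bar>\<close> is at least \<open>3\<lambda>\<close>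
  (\<open>outside_if_square_maximum\<close>, \<open>square_maximum_if_outside\<close>), and this describes the
  complement of the open hexagon (\<open>interior_hexagon_eq\<close>).

  The contact set is not maximally \<open>c\<close>-monotone because \<open>(0, 0, 0)\<close>, whose sum lies inside the
  hexagon, can be added. A pair made of \<open>0\<close> and a contact point \<open>(x, y, z)\<close> satisfies the monotonicity
  inequalities as soon as \<open>x \<bullet> (y + z)\<close>, \<open>y \<bullet> (x + z)\<close> and \<open>z \<bullet> (x + y)\<close> are nonnegative, and this
  follows from \<open>f x \<ge> cost x (\<plusminus>y) (\<plusminus>z)\<close>, the segments being symmetric.
\<close>

section \<open>Unit vectors at sixty degrees\<close>

text \<open>Only the inner products of \<open>u\<close> and \<open>v\<close> matter. They are symmetric in \<open>u\<close> and \<open>v\<close>, so that results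
  about \<open>u, v\<close> can be reused with the roles exchanged.\<close>

locale sixty_degree_frame =
  fixes u v :: plane
  assumes inner_uu: "u \<bullet> u = 1" and inner_vv: "v \<bullet> v = 1" and inner_uv: "u \<bullet> v = 1 / 2"
begin

lemma inner_vu: "v \<bullet> u = 1 / 2"
  using inner_uv by (simp add: inner_commute)

lemmas frame_inner = inner_uu inner_vv inner_uv inner_vu

lemma swap: "sixty_degree_frame v u"
  by unfold_locales (simp_all add: frame_inner)

lemma ex_point_with_inner: "\<exists>x. x \<bullet> u = p \<and> x \<bullet> v = q"
  by (intro exI[of _ "(4 / 3) *\<^sub>R ((p - q / 2) *\<^sub>R u + (q - p / 2) *\<^sub>R v)"])
    (simp add: inner_left_distrib frame_inner algebra_simps)

text \<open>The two vectors span the plane: the square of their determinant is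
  \<open>(u \<bullet> u) (v \<bullet> v) - (u \<bullet> v)\<^sup>2 = 3 / 4\<close>.\<close>

lemma ex_combination: "\<exists>a b. s = a *\<^sub>R u + b *\<^sub>R v"
proof -
  have "u$1 * u$1 + u$2 * u$2 = 1" "v$1 * v$1 + v$2 * v$2 = 1" "u$1 * v$1 + u$2 * v$2 = 1 / 2"
    using inner_uu inner_vv inner_uv by (simp_all add: inner_vec_def sum_2)
  then have "u$1 * v$2 - u$2 * v$1 \<noteq> 0"
    by algebra
  then have "s = ((s$1 * v$2 - s$2 * v$1) / (u$1 * v$2 - u$2 * v$1)) *\<^sub>R u
      + ((u$1 * s$2 - u$2 * s$1) / (u$1 * v$2 - u$2 * v$1)) *\<^sub>R v"
    by (simp add: vec_eq_iff forall_2 divide_simps) (simp add: algebra_simps)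
  then show ?thesis
    by blast
qed

end

section \<open>The three potentials\<close>

text \<open>The convex indicator of the segment from \<open>- l w\<close> to \<open>l w\<close>.\<close>

definition segment_indicator :: "real \<Rightarrow> plane \<Rightarrow> plane \<Rightarrow> ereal" where
  "segment_indicator l w y = (if y \<in> closed_segment (- (l *\<^sub>R w)) (l *\<^sub>R w) then 0 else \<infinity>)"

text \<open>The maximum of \<open>b (x \<bullet> u) + c (x \<bullet> v) + b c / 2\<close> over the four corners \<open>b, c = \<plusminus>l\<close> of a square,
  for \<open>l \<ge> 0\<close>. The coefficient of \<open>b c\<close> is \<open>u \<bullet> v\<close> in a sixty-degree frame, so that this is the cost of
  \<open>x\<close>, \<open>b u\<close> and \<open>c v\<close>. The first entry comes from the corners with \<open>b = c\<close>, the second one from those with \<open>b = - c\<close>.\<close>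

definition corner_max :: "real \<Rightarrow> plane \<Rightarrow> plane \<Rightarrow> plane \<Rightarrow> real" where
  "corner_max l u v x =
     max (l * \<bar>x \<bullet> u + x \<bullet> v\<bar> + l\<^sup>2 / 2) (l * \<bar>x \<bullet> u - x \<bullet> v\<bar> - l\<^sup>2 / 2)"

lemma mem_symmetric_segment_iff:
  fixes w :: plane
  assumes "l > 0"
  shows "y \<in> closed_segment (- (l *\<^sub>R w)) (l *\<^sub>R w) \<longleftrightarrow> (\<exists>c. \<bar>c\<bar> \<le> l \<and> y = c *\<^sub>R w)"
proof
  assume "y \<in> closed_segment (- (l *\<^sub>R w)) (l *\<^sub>R w)"
  then obtain t where t: "0 \<le> t" "t \<le> 1"
    and y: "y = (1 - t) *\<^sub>R (- (l *\<^sub>R w)) + t *\<^sub>R (l *\<^sub>R w)"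
    by (auto simp: closed_segment_def)
  have "y = ((2 * t - 1) * l) *\<^sub>R w"
    unfolding y by (simp add: algebra_simps flip: scaleR_add_left)
  moreover have "\<bar>(2 * t - 1) * l\<bar> \<le> l"
    using t \<open>l > 0\<close> by (simp add: abs_mult mult_le_cancel_right1)
  ultimately show "\<exists>c. \<bar>c\<bar> \<le> l \<and> y = c *\<^sub>R w"
    by blast
next
  assume "\<exists>c. \<bar>c\<bar> \<le> l \<and> y = c *\<^sub>R w"
  then obtain c where c: "\<bar>c\<bar> \<le> l" and y: "y = c *\<^sub>R w"
    by blast
  define t where "t = (c / l + 1) / 2"
  have "0 \<le> t" "t \<le> 1" "c = (2 * t - 1) * l"
    using c \<open>l > 0\<close> by (auto simp: t_def field_simps abs_le_iff)
  then show "y \<in> closed_segment (- (l *\<^sub>R w)) (l *\<^sub>R w)"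
    unfolding closed_segment_def y
    by (intro CollectI exI[of _ t]) (simp add: algebra_simps flip: scaleR_add_left)
qed

lemma segment_indicator_eq_0: "\<bar>c\<bar> \<le> l \<Longrightarrow> l > 0 \<Longrightarrow> segment_indicator l w (c *\<^sub>R w) = 0"
  using mem_symmetric_segment_iff by (auto simp: segment_indicator_def)

lemma segment_indicator_cases:
  assumes "l > 0"
  obtains c where "\<bar>c\<bar> \<le> l" "y = c *\<^sub>R w" "segment_indicator l w y = 0"
  | "segment_indicator l w y = \<infinity>"
  using mem_symmetric_segment_iff[OF assms, of y w] unfolding segment_indicator_def by metis

lemma indicator_in_A:
  fixes S :: "plane set"
  assumes "closed S" "convex S" "S \<noteq> {}"
  shows "(\<lambda>y. if y \<in> S then 0 else \<infinity>) \<in> \<A>"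
proof -
  let ?i = "\<lambda>y. if y \<in> S then (0 :: ereal) else \<infinity>"
  have "?i x \<le> Liminf (at x) ?i" for x
  proof (cases "x \<in> S")
    case True
    then show ?thesis
      by (intro Liminf_bounded) auto
  next
    case False
    then have "\<forall>\<^sub>F y in at x. y \<in> - S"
      using \<open>closed S\<close> by (intro eventually_at_in_open') auto
    then show ?thesis
      by (intro Liminf_bounded) (auto elim: eventually_mono)
  qed
  moreover have "?i ((1 - t) *\<^sub>R x + t *\<^sub>R y) \<le> ereal (1 - t) * ?i x + ereal t * ?i y"
    if "0 < t" "t < 1" for x y t
    using that convexD_alt[OF \<open>convex S\<close>, of x y t] by auto
  ultimately show ?thesis
    using \<open>S \<noteq> {}\<close> by (auto simp: \<A>_def proper_def lsc_def ereal_convex_def)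
qed

lemma continuous_convex_in_A:
  fixes F :: "plane \<Rightarrow> real"
  assumes cont: "continuous_on UNIV F" and conv: "convex_on UNIV F"
  shows "(\<lambda>x. ereal (F x)) \<in> \<A>"
proof -
  have "ereal (F x) \<le> Liminf (at x) (\<lambda>x. ereal (F x))" for x
  proof -
    have "((\<lambda>x. ereal (F x)) \<longlongrightarrow> ereal (F x)) (at x)"
      using cont by (auto simp: continuous_on_def)
    then show ?thesis
      by (metis lim_imp_Liminf order_refl trivial_limit_at)
  qed
  moreover have "F ((1 - t) *\<^sub>R x + t *\<^sub>R y) \<le> (1 - t) * F x + t * F y" if "0 < t" "t < 1" for x y t
    using that convex_onD[OF conv, of t x y] by auto
  ultimately show ?thesis
    by (auto simp: \<A>_def proper_def lsc_def ereal_convex_def)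
qed

lemma segment_indicator_in_A: "segment_indicator l w \<in> \<A>"
proof -
  have "segment_indicator l w = (\<lambda>y. if y \<in> closed_segment (- (l *\<^sub>R w)) (l *\<^sub>R w) then 0 else \<infinity>)"
    by (auto simp: segment_indicator_def)
  then show ?thesis
    by (simp add: indicator_in_A)
qed

lemma corner_max_in_A:
  assumes "l > 0"
  shows "(\<lambda>x. ereal (corner_max l u v x)) \<in> \<A>"
proof (rule continuous_convex_in_A)
  show "continuous_on UNIV (corner_max l u v)"
    unfolding corner_max_def by (intro continuous_intros)
  have abs_convex: "l * \<bar>((1 - t) *\<^sub>R x + t *\<^sub>R y) \<bullet> n\<bar>
      \<le> (1 - t) * (l * \<bar>x \<bullet> n\<bar>) + t * (l * \<bar>y \<bullet> n\<bar>)"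
    if "0 < t" "t < 1" for x y n :: plane and t
  proof -
    have "\<bar>((1 - t) *\<^sub>R x + t *\<^sub>R y) \<bullet> n\<bar> \<le> (1 - t) * \<bar>x \<bullet> n\<bar> + t * \<bar>y \<bullet> n\<bar>"
      using that abs_triangle_ineq[of "(1 - t) * (x \<bullet> n)" "t * (y \<bullet> n)"]
      by (simp add: inner_left_distrib abs_mult)
    from mult_left_mono[OF this, of l] \<open>l > 0\<close> show ?thesis
      by (simp add: algebra_simps)
  qed
  have corner_max_eq: "corner_max l u v x =
      max (l * \<bar>x \<bullet> (u + v)\<bar> + l\<^sup>2 / 2) (l * \<bar>x \<bullet> (u - v)\<bar> - l\<^sup>2 / 2)" for x
    by (simp add: corner_max_def inner_add_right inner_diff_right)
  show "convex_on UNIV (corner_max l u v)"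
  proof (rule convex_onI)
    fix t :: real and x y :: plane
    assume t: "0 < t" "t < 1"
    let ?m = "(1 - t) * corner_max l u v x + t * corner_max l u v y"
    have "(1 - t) * (l * \<bar>x \<bullet> (u + v)\<bar> + l\<^sup>2 / 2) + t * (l * \<bar>y \<bullet> (u + v)\<bar> + l\<^sup>2 / 2) \<le> ?m"
      and "(1 - t) * (l * \<bar>x \<bullet> (u - v)\<bar> - l\<^sup>2 / 2) + t * (l * \<bar>y \<bullet> (u - v)\<bar> - l\<^sup>2 / 2) \<le> ?m"
      unfolding corner_max_eq using t by (intro add_mono mult_left_mono; simp)+
    moreover have "(1 - t) * (a + d) + t * (b + d) = (1 - t) * a + t * b + d" for a b d
      by (simp add: algebra_simps)
    from this[of _ "l\<^sup>2 / 2"] this[of _ "- (l\<^sup>2 / 2)"] calculation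
    have "(1 - t) * (l * \<bar>x \<bullet> (u + v)\<bar>) + t * (l * \<bar>y \<bullet> (u + v)\<bar>) + l\<^sup>2 / 2 \<le> ?m"
      and "(1 - t) * (l * \<bar>x \<bullet> (u - v)\<bar>) + t * (l * \<bar>y \<bullet> (u - v)\<bar>) - l\<^sup>2 / 2 \<le> ?m"
      by simp_all
    with abs_convex[OF t, of x y "u + v"] abs_convex[OF t, of x y "u - v"]
    have "l * \<bar>((1 - t) *\<^sub>R x + t *\<^sub>R y) \<bullet> (u + v)\<bar> + l\<^sup>2 / 2 \<le> ?m"
      and "l * \<bar>((1 - t) *\<^sub>R x + t *\<^sub>R y) \<bullet> (u - v)\<bar> - l\<^sup>2 / 2 \<le> ?m"
      by linarith+
    then show "corner_max l u v ((1 - t) *\<^sub>R x + t *\<^sub>R y) \<le> ?m"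
      by (subst corner_max_eq) simp
  qed simp
qed

section \<open>Conjugacy\<close>

lemma cost_swap: "cost x y z = cost y x z"
  by (simp add: cost_def inner_commute)

lemma c_conj_commute: "c_conj \<phi> \<psi> = c_conj \<psi> \<phi>"
proof
  fix z
  have "c_conj \<phi> \<psi> z \<le> c_conj \<psi> \<phi> z" for \<phi> \<psi>
    unfolding c_conj_def
  proof (rule SUP_least, clarify)
    fix x y
    have "ereal (cost x y z) - \<phi> x - \<psi> y = ereal (cost y x z) - \<psi> y - \<phi> x"
      unfolding cost_swap[of x y] by (cases "\<phi> x"; cases "\<psi> y") auto
    also have "\<dots> \<le> (SUP (x, y) \<in> UNIV. ereal (cost x y z) - \<psi> x - \<phi> y)"
      by (rule SUP_upper2[of "(y, x)"]) auto
    finally show "ereal (cost x y z) - \<phi> x - \<psi> y \<le> \<dots>" .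
  qed
  then show "c_conj \<phi> \<psi> z = c_conj \<psi> \<phi> z"
    by (intro antisym)
qed

lemma c_conj_upper: "ereal (cost x y z) - \<phi> x - \<psi> y \<le> c_conj \<phi> \<psi> z"
  unfolding c_conj_def by (rule SUP_upper2[of "(x, y)"]) auto

lemma corner_max_commute: "corner_max l u v = corner_max l v u"
  by (auto simp: corner_max_def add.commute abs_minus_commute)

text \<open>The left-hand side is affine in \<open>b\<close> and in \<open>c\<close>, so it is largest at a corner of the square.\<close>

lemma bilinear_le_corner:
  fixes b c p q l :: real
  assumes "\<bar>b\<bar> \<le> l" "\<bar>c\<bar> \<le> l"
  shows "b * p + c * q + b * c / 2 \<le> max (l * \<bar>p + q\<bar> + l\<^sup>2 / 2) (l * \<bar>p - q\<bar> - l\<^sup>2 / 2)"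
proof -
  have le_abs: "a * m \<le> l * \<bar>m\<bar>" if "\<bar>a\<bar> \<le> l" for a m :: real
  proof -
    have "a * m \<le> \<bar>a\<bar> * \<bar>m\<bar>"
      by (simp flip: abs_mult)
    also have "\<dots> \<le> l * \<bar>m\<bar>"
      using that by (rule mult_right_mono) simp
    finally show ?thesis .
  qed
  have corner: "l * m + l\<^sup>2 / 2 \<le> max (l * \<bar>p + q\<bar> + l\<^sup>2 / 2) (l * \<bar>p - q\<bar> - l\<^sup>2 / 2)"
      "l * n - l\<^sup>2 / 2 \<le> max (l * \<bar>p + q\<bar> + l\<^sup>2 / 2) (l * \<bar>p - q\<bar> - l\<^sup>2 / 2)"
    if "\<bar>m\<bar> = \<bar>p + q\<bar>" "\<bar>n\<bar> = \<bar>p - q\<bar>" for m n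
  proof -
    have "l * m \<le> l * \<bar>m\<bar>" "l * n \<le> l * \<bar>n\<bar>"
      using le_abs[of l] assms by auto
    then show "l * m + l\<^sup>2 / 2 \<le> max (l * \<bar>p + q\<bar> + l\<^sup>2 / 2) (l * \<bar>p - q\<bar> - l\<^sup>2 / 2)"
      "l * n - l\<^sup>2 / 2 \<le> max (l * \<bar>p + q\<bar> + l\<^sup>2 / 2) (l * \<bar>p - q\<bar> - l\<^sup>2 / 2)"
      unfolding that by simp_all
  qed
  have "b * p + c * q + b * c / 2 = b * (p + c / 2) + c * q"
    by (simp add: algebra_simps)
  also have "\<dots> \<le> l * \<bar>p + c / 2\<bar> + c * q"
    using le_abs[OF assms(1)] by simp
  also have "\<dots> \<le> max (l * \<bar>p + q\<bar> + l\<^sup>2 / 2) (l * \<bar>p - q\<bar> - l\<^sup>2 / 2)"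
  proof (cases "p + c / 2 \<ge> 0")
    case True
    then have "l * \<bar>p + c / 2\<bar> + c * q = l * p + c * (q + l / 2)"
      by (simp add: algebra_simps)
    also have "\<dots> \<le> l * p + l * \<bar>q + l / 2\<bar>"
      using le_abs[OF assms(2)] by simp
    also have "\<dots> \<le> max (l * \<bar>p + q\<bar> + l\<^sup>2 / 2) (l * \<bar>p - q\<bar> - l\<^sup>2 / 2)"
      using corner[of "p + q" "p - q"]
      by (cases "q + l / 2 \<ge> 0") (simp_all add: algebra_simps power2_eq_square)
    finally show ?thesis .
  next
    case False
    then have "l * \<bar>p + c / 2\<bar> + c * q = - l * p + c * (q - l / 2)"
      by (simp add: algebra_simps)
    also have "\<dots> \<le> - l * p + l * \<bar>q - l / 2\<bar>"
      using le_abs[OF assms(2)] by simp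
    also have "\<dots> \<le> max (l * \<bar>p + q\<bar> + l\<^sup>2 / 2) (l * \<bar>p - q\<bar> - l\<^sup>2 / 2)"
      using corner[of "- (p + q)" "- (p - q)"]
      by (cases "q - l / 2 \<ge> 0") (simp_all add: algebra_simps power2_eq_square)
    finally show ?thesis .
  qed
  finally show ?thesis .
qed

lemma corner_max_attained:
  assumes "l > 0"
  obtains b c where "\<bar>b\<bar> \<le> l" "\<bar>c\<bar> \<le> l"
    "corner_max l u v x = b * (x \<bullet> u) + c * (x \<bullet> v) + b * c / 2"
proof -
  have "\<exists>b c. \<bar>b\<bar> \<le> l \<and> \<bar>c\<bar> \<le> l \<and> corner_max l u v x = b * (x \<bullet> u) + c * (x \<bullet> v) + b * c / 2"
  proof (cases "l * \<bar>x \<bullet> u - x \<bullet> v\<bar> - l\<^sup>2 / 2 \<le> l * \<bar>x \<bullet> u + x \<bullet> v\<bar> + l\<^sup>2 / 2")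
    case True
    let ?e = "if x \<bullet> u + x \<bullet> v \<ge> 0 then l else - l"
    have "corner_max l u v x = ?e * (x \<bullet> u) + ?e * (x \<bullet> v) + ?e * ?e / 2"
      using True by (simp add: corner_max_def max_absorb1) (simp add: power2_eq_square algebra_simps)
    moreover have "\<bar>?e\<bar> \<le> l"
      using assms by simp
    ultimately show ?thesis
      by blast
  next
    case False
    let ?e = "if x \<bullet> u - x \<bullet> v \<ge> 0 then l else - l"
    have "corner_max l u v x = ?e * (x \<bullet> u) + - ?e * (x \<bullet> v) + ?e * - ?e / 2"
      using False by (simp add: corner_max_def max_absorb2) (simp add: power2_eq_square algebra_simps)
    moreover have "\<bar>?e\<bar> \<le> l" "\<bar>- ?e\<bar> \<le> l"
      using assms by simp_all
    ultimately show ?thesis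
      by blast
  qed
  then show ?thesis
    using that by blast
qed

context sixty_degree_frame
begin

lemma cost_segments:
  "cost x (b *\<^sub>R u) (c *\<^sub>R v) = b * (x \<bullet> u) + c * (x \<bullet> v) + b * c / 2"
  by (simp add: cost_def inner_uv inner_commute)

lemma cost_le_corner_max:
  assumes "\<bar>b\<bar> \<le> l" "\<bar>c\<bar> \<le> l"
  shows "cost x (b *\<^sub>R u) (c *\<^sub>R v) \<le> corner_max l u v x"
  unfolding cost_segments corner_max_def by (rule bilinear_le_corner[OF assms])

lemma c_conj_segments:
  assumes "l > 0"
  shows "c_conj (segment_indicator l u) (segment_indicator l v) = (\<lambda>x. ereal (corner_max l u v x))"
proof (rule ext, rule antisym)
  fix x
  have "ereal (cost y z x) - segment_indicator l u y - segment_indicator l v z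
      \<le> ereal (corner_max l u v x)" for y z
  proof -
    have "cost y z x = cost x y z"
      by (simp add: cost_def inner_commute)
    then show ?thesis
      using cost_le_corner_max[of _ l _ x]
      by (cases y rule: segment_indicator_cases[OF assms, where w = u];
          cases z rule: segment_indicator_cases[OF assms, where w = v]) auto
  qed
  then show "c_conj (segment_indicator l u) (segment_indicator l v) x \<le> ereal (corner_max l u v x)"
    unfolding c_conj_def by (intro SUP_least) auto
  obtain b c where bc: "\<bar>b\<bar> \<le> l" "\<bar>c\<bar> \<le> l"
    "corner_max l u v x = b * (x \<bullet> u) + c * (x \<bullet> v) + b * c / 2"
    using corner_max_attained[OF assms] .
  have "cost (b *\<^sub>R u) (c *\<^sub>R v) x = corner_max l u v x"
    unfolding bc(3) cost_segments[symmetric] by (simp add: cost_def inner_commute)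
  with c_conj_upper[of "b *\<^sub>R u" "c *\<^sub>R v" x "segment_indicator l u" "segment_indicator l v"]
  show "ereal (corner_max l u v x) \<le> c_conj (segment_indicator l u) (segment_indicator l v) x"
    using bc assms by (simp add: segment_indicator_eq_0)
qed

lemma c_conj_corner_max:
  assumes "l > 0"
  shows "c_conj (\<lambda>x. ereal (corner_max l u v x)) (segment_indicator l u) = segment_indicator l v"
proof
  fix z
  let ?F = "\<lambda>x. ereal (corner_max l u v x)" and ?g = "segment_indicator l u"
  have upper: "ereal (cost x (b *\<^sub>R u) z - corner_max l u v x) \<le> c_conj ?F ?g z" if "\<bar>b\<bar> \<le> l" for x b
    using c_conj_upper[of x "b *\<^sub>R u" z ?F ?g] that assms by (simp add: segment_indicator_eq_0)
  show "c_conj ?F ?g z = segment_indicator l v z"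
  proof (cases "z \<in> closed_segment (- (l *\<^sub>R v)) (l *\<^sub>R v)")
    case True
    then obtain c where c: "\<bar>c\<bar> \<le> l" and z: "z = c *\<^sub>R v"
      using mem_symmetric_segment_iff[OF assms] by blast
    have "ereal (cost x y z) - ?F x - ?g y \<le> 0" for x y
      using cost_le_corner_max[OF _ c, of _ x]
      by (cases y rule: segment_indicator_cases[OF assms, where w = u]) (auto simp: z)
    then have "c_conj ?F ?g z \<le> 0"
      unfolding c_conj_def by (intro SUP_least) auto
    \<comment> \<open>Here the corners \<open>(l, l)\<close> and \<open>(l, - l)\<close> give the same value, so every point \<open>(l, c)\<close> of that
      edge of the square attains the maximum.\<close>
    moreover obtain x where x: "x \<bullet> u = l / 2" "x \<bullet> v = - l / 2"
      using ex_point_with_inner by blast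
    have "cost x (l *\<^sub>R u) z - corner_max l u v x = 0"
      unfolding z cost_segments using x assms
      by (simp add: corner_max_def power2_eq_square algebra_simps)
    with upper[of l x] assms have "0 \<le> c_conj ?F ?g z"
      by (simp add: zero_ereal_def)
    ultimately show ?thesis
      using True by (simp add: segment_indicator_def)
  next
    case False
    obtain a b where z: "z = a *\<^sub>R u + b *\<^sub>R v"
      using ex_combination by blast
    have "ereal B \<le> c_conj ?F ?g z" for B
    proof (cases "a = 0")
      case True
      have b: "\<bar>b\<bar> > l"
        using False z True mem_symmetric_segment_iff[OF assms, of z v]
        by (metis add_0 not_le scale_zero_left)
      \<comment> \<open>Perpendicular to \<open>u\<close>, the term \<open>z \<bullet> x\<close> grows at rate \<open>\<bar>b\<bar>\<close> and \<open>corner_max\<close> only at rate \<open>l\<close>.\<close>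
      define N where "N = (\<bar>B\<bar> + l\<^sup>2) / (\<bar>b\<bar> - l)"
      have N: "N \<ge> 0" "N * (\<bar>b\<bar> - l) = \<bar>B\<bar> + l\<^sup>2"
        using b by (auto simp: N_def)
      obtain x where x: "x \<bullet> u = 0" "x \<bullet> v = sgn b * N"
        using ex_point_with_inner by blast
      have "cost x (0 *\<^sub>R u) z - corner_max l u v x \<ge> \<bar>B\<bar>"
      proof -
        have "z \<bullet> x = \<bar>b\<bar> * N"
          using x True by (simp add: z inner_commute[of _ x] inner_add_right abs_sgn)
        moreover have "corner_max l u v x = l * N + l\<^sup>2 / 2"
          using x N(1) b assms by (auto simp: corner_max_def abs_mult abs_sgn_eq)
        ultimately show ?thesis
          using N(2) by (simp add: cost_def algebra_simps)
      qed
      then have "ereal B \<le> ereal (cost x (0 *\<^sub>R u) z - corner_max l u v x)"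
        by simp
      also have "\<dots> \<le> c_conj ?F ?g z"
        using assms by (intro upper) simp
      finally show ?thesis .
    next
      case False
      \<comment> \<open>Perpendicular to \<open>v\<close>, the endpoint \<open>sgn a * l *\<^sub>R u\<close> of the segment cancels the growth of
        \<open>corner_max\<close>, and \<open>z \<bullet> x\<close> grows at rate \<open>\<bar>a\<bar>\<close>.\<close>
      define N where "N = (\<bar>B\<bar> + l\<^sup>2 + l * \<bar>z \<bullet> u\<bar>) / \<bar>a\<bar>"
      have N: "N \<ge> 0" "\<bar>a\<bar> * N = \<bar>B\<bar> + l\<^sup>2 + l * \<bar>z \<bullet> u\<bar>"
        using False assms by (auto simp: N_def)
      obtain x where x: "x \<bullet> u = sgn a * N" "x \<bullet> v = 0"
        using ex_point_with_inner by blast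
      have "cost x ((sgn a * l) *\<^sub>R u) z - corner_max l u v x \<ge> \<bar>B\<bar>"
      proof -
        have "z \<bullet> x = \<bar>a\<bar> * N"
          using x by (simp add: z inner_commute[of _ x] inner_add_right abs_sgn)
        moreover have "corner_max l u v x = l * N + l\<^sup>2 / 2"
          using x N(1) False by (simp add: corner_max_def abs_mult)
        moreover have "x \<bullet> ((sgn a * l) *\<^sub>R u) = l * N"
          using x False by (simp add: sgn_if)
        moreover have "((sgn a * l) *\<^sub>R u) \<bullet> z \<ge> - (l * \<bar>z \<bullet> u\<bar>)"
          using False assms
          by (auto simp: sgn_if inner_commute[of u] abs_if mult_le_0_iff)
        ultimately show ?thesis
          using N(2) zero_le_power2[of l] unfolding cost_def by linarith
      qed
      then have "ereal B \<le> ereal (cost x ((sgn a * l) *\<^sub>R u) z - corner_max l u v x)"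
        by simp
      also have "\<dots> \<le> c_conj ?F ?g z"
        using assms by (intro upper) (simp add: sgn_if)
      finally show ?thesis .
    qed
    then show ?thesis
      using False by (auto simp: segment_indicator_def intro: ereal_top)
  qed
qed

end

section \<open>The hexagon\<close>

lemma convex_mem_subcombination:
  fixes p q :: "'a :: real_vector"
  assumes "convex S" "p \<in> S" "q \<in> S" "0 \<in> S" "0 \<le> c" "0 \<le> d" "c + d \<le> 1"
  shows "c *\<^sub>R p + d *\<^sub>R q \<in> S"
proof (cases "c + d = 0")
  case True
  then show ?thesis
    using assms by (simp add: add_nonneg_eq_0_iff)
next
  case False
  then have "(c / (c + d)) *\<^sub>R p + (d / (c + d)) *\<^sub>R q \<in> S"
    using assms by (intro mem_convex_alt) auto
  then have "(1 - (c + d)) *\<^sub>R 0 + (c + d) *\<^sub>R ((c / (c + d)) *\<^sub>R p + (d / (c + d)) *\<^sub>R q) \<in> S"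
    using assms by (intro convexD_alt) auto
  then show ?thesis
    using False by (simp add: scaleR_add_right)
qed

context sixty_degree_frame
begin

text \<open>In coordinates \<open>s = a u + b v\<close> the three conditions read \<open>\<bar>a + b\<bar>, \<bar>a\<bar>, \<bar>b\<bar> \<le> 2 l\<close>. The six sign patterns
  of \<open>a\<close>, \<open>b\<close> and \<open>a + b\<close> cut this set into the triangles spanned by \<open>0\<close> and two adjacent vertices.\<close>

lemma hexagon_eq:
  assumes "l > 0"
  shows "hexagon u v l = {s. \<bar>s \<bullet> (u + v)\<bar> \<le> 3 * l \<and> \<bar>s \<bullet> (2 *\<^sub>R u - v)\<bar> \<le> 3 * l
    \<and> \<bar>s \<bullet> (2 *\<^sub>R v - u)\<bar> \<le> 3 * l}" (is "_ = ?P")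
proof
  have slab: "convex {s. \<bar>s \<bullet> n\<bar> \<le> 3 * l}" for n :: plane
  proof -
    have "{s. \<bar>s \<bullet> n\<bar> \<le> 3 * l} = {s. n \<bullet> s \<le> 3 * l} \<inter> {s. n \<bullet> s \<ge> - (3 * l)}"
      by (auto simp: inner_commute abs_le_iff)
    then show ?thesis
      by (simp add: convex_Int convex_halfspace_le convex_halfspace_ge)
  qed
  have "?P = {s. \<bar>s \<bullet> (u + v)\<bar> \<le> 3 * l} \<inter> {s. \<bar>s \<bullet> (2 *\<^sub>R u - v)\<bar> \<le> 3 * l}
      \<inter> {s. \<bar>s \<bullet> (2 *\<^sub>R v - u)\<bar> \<le> 3 * l}"
    by auto
  then have "convex ?P"
    by (simp add: convex_Int slab)
  then show "hexagon u v l \<subseteq> ?P"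
    unfolding hexagon_def using \<open>l > 0\<close>
    by (intro hull_minimal) (simp_all add: inner_simps frame_inner)
next
  have conv: "convex (hexagon u v l)"
    by (simp add: hexagon_def)
  have vertices: "(2 * l) *\<^sub>R u \<in> hexagon u v l" "(2 * l) *\<^sub>R v \<in> hexagon u v l"
    "(2 * l) *\<^sub>R (v - u) \<in> hexagon u v l" "- ((2 * l) *\<^sub>R u) \<in> hexagon u v l"
    "- ((2 * l) *\<^sub>R v) \<in> hexagon u v l" "- ((2 * l) *\<^sub>R (v - u)) \<in> hexagon u v l"
    by (simp_all add: hexagon_def hull_inc)
  have "0 = (1 - 1 / 2) *\<^sub>R ((2 * l) *\<^sub>R u) + (1 / 2) *\<^sub>R - ((2 * l) *\<^sub>R u)"
    by simp
  then have zero: "0 \<in> hexagon u v l"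
    using convexD_alt[OF conv vertices(1) vertices(4), of "1 / 2"] by simp
  note combination = convex_mem_subcombination[OF conv _ _ zero]
  show "?P \<subseteq> hexagon u v l"
  proof
    fix s
    assume s: "s \<in> ?P"
    obtain a b where ab: "s = a *\<^sub>R u + b *\<^sub>R v"
      using ex_combination by blast
    have bounds: "\<bar>a\<bar> \<le> 2 * l" "\<bar>b\<bar> \<le> 2 * l" "\<bar>a + b\<bar> \<le> 2 * l"
      using s unfolding ab by (simp_all add: inner_simps frame_inner abs_le_iff)
    have sector: "c *\<^sub>R p + d *\<^sub>R q \<in> hexagon u v l"
      if "(2 * l) *\<^sub>R p \<in> hexagon u v l" "(2 * l) *\<^sub>R q \<in> hexagon u v l"
        "0 \<le> c" "0 \<le> d" "c + d \<le> 2 * l" for c d p q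
      using combination[OF that(1,2), of "c / (2 * l)" "d / (2 * l)"] that \<open>l > 0\<close>
      by (simp add: divide_simps)
    have vertices': "(2 * l) *\<^sub>R (- u) \<in> hexagon u v l" "(2 * l) *\<^sub>R (- v) \<in> hexagon u v l"
      "(2 * l) *\<^sub>R (u - v) \<in> hexagon u v l"
      using vertices(4-6) by (simp_all add: algebra_simps)
    consider "0 \<le> a" "0 \<le> b" | "a \<le> 0" "b \<le> 0" | "0 \<le> a" "b \<le> 0" "0 \<le> a + b"
      | "0 \<le> a" "b \<le> 0" "a + b \<le> 0" | "a \<le> 0" "0 \<le> b" "0 \<le> a + b"
      | "a \<le> 0" "0 \<le> b" "a + b \<le> 0"
      by linarith
    then show "s \<in> hexagon u v l"
    proof cases
      case 1
      then show ?thesis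
        using sector[OF vertices(1) vertices(2), of a b] bounds by (simp add: ab)
    next
      case 2
      then show ?thesis
        using sector[OF vertices'(1) vertices'(2), of "- a" "- b"] bounds by (simp add: ab)
    next
      case 3
      then show ?thesis
        using sector[OF vertices(1) vertices'(3), of "a + b" "- b"] bounds
        by (simp add: ab algebra_simps)
    next
      case 4
      then show ?thesis
        using sector[OF vertices'(3) vertices'(2), of a "- (a + b)"] bounds
        by (simp add: ab algebra_simps)
    next
      case 5
      then show ?thesis
        using sector[OF vertices(3) vertices(2), of "- a" "a + b"] bounds
        by (simp add: ab algebra_simps)
    next
      case 6
      then show ?thesis
        using sector[OF vertices'(1) vertices(3), of "- (a + b)" b] bounds
        by (simp add: ab algebra_simps)
    qed
  qed
qed

lemma interior_hexagon_eq:
  assumes "l > 0"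
  shows "interior (hexagon u v l) = {s. \<bar>s \<bullet> (u + v)\<bar> < 3 * l \<and> \<bar>s \<bullet> (2 *\<^sub>R u - v)\<bar> < 3 * l
    \<and> \<bar>s \<bullet> (2 *\<^sub>R v - u)\<bar> < 3 * l}"
proof -
  have slab: "interior {s. \<bar>s \<bullet> n\<bar> \<le> 3 * l} = {s. \<bar>s \<bullet> n\<bar> < 3 * l}" if "n \<noteq> 0" for n :: plane
  proof -
    have "{s. \<bar>s \<bullet> n\<bar> \<le> 3 * l} = {s. n \<bullet> s \<le> 3 * l} \<inter> {s. n \<bullet> s \<ge> - (3 * l)}"
      by (auto simp: inner_commute abs_le_iff)
    moreover have "{s. \<bar>s \<bullet> n\<bar> < 3 * l} = {s. n \<bullet> s < 3 * l} \<inter> {s. n \<bullet> s > - (3 * l)}"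
      by (auto simp: inner_commute abs_less_iff)
    ultimately show ?thesis
      using that
      by (simp only: interior_Int interior_halfspace_le interior_halfspace_ge not_False_eq_True)
  qed
  have "n \<noteq> 0" if "n \<bullet> n \<noteq> 0" for n :: plane
    using that by auto
  moreover have "(u + v) \<bullet> (u + v) = 3" "(2 *\<^sub>R u - v) \<bullet> (2 *\<^sub>R u - v) = 3"
    "(2 *\<^sub>R v - u) \<bullet> (2 *\<^sub>R v - u) = 3"
    by (simp_all add: inner_simps frame_inner)
  ultimately have nonzero: "u + v \<noteq> 0" "2 *\<^sub>R u - v \<noteq> 0" "2 *\<^sub>R v - u \<noteq> 0"
    by (metis zero_neq_numeral)+
  have "hexagon u v l = {s. \<bar>s \<bullet> (u + v)\<bar> \<le> 3 * l} \<inter> {s. \<bar>s \<bullet> (2 *\<^sub>R u - v)\<bar> \<le> 3 * l}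
      \<inter> {s. \<bar>s \<bullet> (2 *\<^sub>R v - u)\<bar> \<le> 3 * l}"
    unfolding hexagon_eq[OF assms] by auto
  then show ?thesis
    by (auto simp: slab[OF nonzero(1)] slab[OF nonzero(2)] slab[OF nonzero(3)])
qed

section \<open>The sums of contact points\<close>

abbreviation contact :: "real \<Rightarrow> (plane \<times> plane \<times> plane) set" where
  "contact l \<equiv>
    contact_set (\<lambda>x. ereal (corner_max l u v x)) (segment_indicator l u) (segment_indicator l v)"

lemma mem_contact_iff:
  assumes "l > 0"
  shows "(x, y, z) \<in> contact l \<longleftrightarrow>
    (\<exists>b c. \<bar>b\<bar> \<le> l \<and> \<bar>c\<bar> \<le> l \<and> y = b *\<^sub>R u \<and> z = c *\<^sub>R v \<and> corner_max l u v x = cost x y z)"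
  unfolding contact_set_def cost_def[symmetric]
  using assms
  by (cases y rule: segment_indicator_cases[OF assms, where w = u];
      cases z rule: segment_indicator_cases[OF assms, where w = v])
    (auto simp: segment_indicator_eq_0)

end

text \<open>Here \<open>P = S - b\<close> and \<open>Q = T - c\<close> in terms of the coordinates \<open>S = s \<bullet> u\<close> and \<open>T = s \<bullet> v\<close> of the sum.
  Varying one variable at a time shows that \<open>P\<close> and \<open>Q\<close> vanish unless \<open>b\<close> or \<open>c\<close>, respectively, is an
  endpoint of \<open>[- l, l]\<close>; the comparison with a corner that differs in both variables then yields the
  bound.\<close>

lemma outside_if_square_maximum:
  fixes b c P Q l :: real
  assumes "l > 0" "\<bar>b\<bar> \<le> l" "\<bar>c\<bar> \<le> l"
    and max: "\<And>b' c'. \<bar>b'\<bar> \<le> l \<Longrightarrow> \<bar>c'\<bar> \<le> l \<Longrightarrow>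
      (b' - b) * P + (c' - c) * Q + (b' - b) * (c' - c) / 2 \<le> 0"
  shows "3 * l \<le> \<bar>(P + b) + (Q + c)\<bar> \<or> 3 * l \<le> \<bar>2 * (P + b) - (Q + c)\<bar>
    \<or> 3 * l \<le> \<bar>2 * (Q + c) - (P + b)\<bar>"
proof -
  have P: "P > 0 \<Longrightarrow> b = l" "P < 0 \<Longrightarrow> b = - l"
    using max[of l c] max[of "-l" c] assms(1-3) by (auto simp: mult_le_0_iff)
  have Q: "Q > 0 \<Longrightarrow> c = l" "Q < 0 \<Longrightarrow> c = - l"
    using max[of b l] max[of b "-l"] assms(1-3) by (auto simp: mult_le_0_iff)
  have corners:
    "(l - b) * P + (l - c) * Q + (l - b) * (l - c) / 2 \<le> 0"
    "(l - b) * P + (- l - c) * Q + (l - b) * (- l - c) / 2 \<le> 0"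
    "(- l - b) * P + (l - c) * Q + (- l - b) * (l - c) / 2 \<le> 0"
    "(- l - b) * P + (- l - c) * Q + (- l - b) * (- l - c) / 2 \<le> 0"
    using \<open>l > 0\<close> by (intro max; simp)+
  have cancel: "m \<le> 0" if "l * m \<le> 0" for m
    using that \<open>l > 0\<close> by (simp add: mult_le_0_iff)
  consider "P = 0" "Q = 0" | "P > 0" "Q = 0" | "P < 0" "Q = 0" | "P = 0" "Q > 0" | "P = 0" "Q < 0"
    | "P > 0" "Q > 0" | "P > 0" "Q < 0" | "P < 0" "Q > 0" | "P < 0" "Q < 0"
    by linarith
  then show ?thesis
  proof cases
    case 1
    then have "(l - b) * (l - c) \<le> 0" "(- l - b) * (- l - c) \<le> 0"
      using corners by simp_all
    then have "b = l \<and> c = - l \<or> b = - l \<and> c = l"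
      using assms(1-3) by (auto simp: mult_le_0_iff)
    then show ?thesis
      using 1 \<open>l > 0\<close> by (elim disjE) simp_all
  next
    case 2
    have "l + c - 2 * P \<le> 0"
      using corners 2 P
      by - (rule cancel, simp add: algebra_simps add_divide_distrib diff_divide_distrib)
    then show ?thesis
      using 2 P by (auto simp: abs_if)
  next
    case 3
    have "l - c + 2 * P \<le> 0"
      using corners 3 P
      by - (rule cancel, simp add: algebra_simps add_divide_distrib diff_divide_distrib)
    then show ?thesis
      using 3 P by (auto simp: abs_if)
  next
    case 4
    have "l + b - 2 * Q \<le> 0"
      using corners 4 Q
      by - (rule cancel, simp add: algebra_simps add_divide_distrib diff_divide_distrib)
    then show ?thesis
      using 4 Q by (auto simp: abs_if)
  next
    case 5
    have "l - b + 2 * Q \<le> 0"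
      using corners 5 Q
      by - (rule cancel, simp add: algebra_simps add_divide_distrib diff_divide_distrib)
    then show ?thesis
      using 5 Q by (auto simp: abs_if)
  next
    case 6
    have "l - P - Q \<le> 0"
      using corners 6 P Q
      by - (rule cancel, simp add: algebra_simps add_divide_distrib diff_divide_distrib)
    then show ?thesis
      using 6 P Q by (auto simp: abs_if)
  next
    case 9
    have "l + P + Q \<le> 0"
      using corners 9 P Q
      by - (rule cancel, simp add: algebra_simps add_divide_distrib diff_divide_distrib)
    then show ?thesis
      using 9 P Q by (auto simp: abs_if)
  qed (use P Q \<open>l > 0\<close> in auto)
qed

text \<open>The case \<open>S \<ge> l\<close>, in which the projection of \<open>S\<close> to \<open>[- l, l]\<close> is \<open>l\<close>. The other cases reduce to it by
  the symmetries \<open>(S, T) \<mapsto> (T, S)\<close> and \<open>(S, T) \<mapsto> (- S, - T)\<close>; one of them always applies, since the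
  open hexagon contains the square \<open>\<bar>S\<bar>, \<bar>T\<bar> < l\<close>.\<close>

lemma square_maximum_if_outside_right:
  fixes c S T l :: real
  assumes "l > 0" "l \<le> S"
    and out: "3 * l \<le> \<bar>S + T\<bar> \<or> 3 * l \<le> \<bar>2 * S - T\<bar> \<or> 3 * l \<le> \<bar>2 * T - S\<bar>"
    and c: "c = max (- l) (min l T)"
    and b': "\<bar>b'\<bar> \<le> l" and c': "\<bar>c'\<bar> \<le> l"
  shows "(b' - l) * (S - l) + (c' - c) * (T - c) + (b' - l) * (c' - c) / 2 \<le> 0"
proof -
  define \<beta> where "\<beta> = l - b'"
  have \<beta>: "0 \<le> \<beta>" "\<beta> \<le> 2 * l" "b' = l - \<beta>"
    using b' by (auto simp: \<beta>_def)
  consider "T \<ge> l" | "T \<le> - l" | "\<bar>T\<bar> < l"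
    by linarith
  then show ?thesis
  proof cases
    case 1
    then have c_eq: "c = l"
      using c \<open>l > 0\<close> by simp
    define \<gamma> where "\<gamma> = l - c'"
    have \<gamma>: "0 \<le> \<gamma>" "\<gamma> \<le> 2 * l" "c' = l - \<gamma>"
      using c' by (auto simp: \<gamma>_def)
    have PQ: "l \<le> (S - l) + (T - l)" "0 \<le> S - l" "0 \<le> T - l"
      using 1 \<open>l \<le> S\<close> out by auto
    have "\<beta> * \<gamma> / 2 = min \<beta> \<gamma> * (max \<beta> \<gamma> / 2)"
      by (simp add: min_def max_def)
    also have "\<dots> \<le> min \<beta> \<gamma> * ((S - l) + (T - l))"
      using \<beta> \<gamma> PQ by (intro mult_left_mono) auto
    also have "\<dots> \<le> \<beta> * (S - l) + \<gamma> * (T - l)"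
      unfolding distrib_left using PQ by (intro add_mono mult_right_mono) auto
    finally show ?thesis
      unfolding c_eq \<beta>(3) \<gamma>(3) by (simp add: algebra_simps add_divide_distrib diff_divide_distrib)
  next
    case 2
    then have c_eq: "c = - l"
      using c \<open>l > 0\<close> by simp
    have "0 \<le> \<beta> * (S - l)" "(c' + l) * (T + l) \<le> 0" "0 \<le> \<beta> * (c' + l)"
      using \<beta> c' 2 \<open>l \<le> S\<close> by (auto simp: mult_le_0_iff)
    then show ?thesis
      unfolding c_eq \<beta>(3) by (simp add: algebra_simps add_divide_distrib diff_divide_distrib)
  next
    case 3
    then have c_eq: "c = T"
      using c by simp
    have "3 * l \<le> 2 * S - T"
      using out 3 \<open>l \<le> S\<close> by linarith
    then have "0 \<le> (S - l) + (c' - T) / 2"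
      using abs_le_D2[OF c'] by (simp add: field_simps)
    then have "0 \<le> \<beta> * ((S - l) + (c' - T) / 2)"
      using \<beta>(1) by simp
    then show ?thesis
      unfolding c_eq \<beta>(3) by (simp add: algebra_simps add_divide_distrib diff_divide_distrib)
  qed
qed

lemma square_maximum_if_outside:
  fixes b c S T l :: real
  assumes "l > 0"
    and out: "3 * l \<le> \<bar>S + T\<bar> \<or> 3 * l \<le> \<bar>2 * S - T\<bar> \<or> 3 * l \<le> \<bar>2 * T - S\<bar>"
    and b: "b = max (- l) (min l S)" and c: "c = max (- l) (min l T)"
    and "\<bar>b'\<bar> \<le> l" "\<bar>c'\<bar> \<le> l"
  shows "(b' - b) * (S - b) + (c' - c) * (T - c) + (b' - b) * (c' - c) / 2 \<le> 0"
proof -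
  have neg: "- max (- l) (min l x) = max (- l) (min l (- x))" for x
    using \<open>l > 0\<close> by auto
  have out': "3 * l \<le> \<bar>- S + - T\<bar> \<or> 3 * l \<le> \<bar>2 * - S - - T\<bar> \<or> 3 * l \<le> \<bar>2 * - T - - S\<bar>"
    using out by linarith
  note right = square_maximum_if_outside_right[OF \<open>l > 0\<close>]
  consider "l \<le> S" | "l \<le> - S" | "l \<le> T" | "l \<le> - T"
    using out \<open>l > 0\<close> by linarith
  then show ?thesis
  proof cases
    case 1
    then have "b = l"
      using b \<open>l > 0\<close> by simp
    with right[OF 1 out c, of b' c'] assms(5,6) show ?thesis
      by simp
  next
    case 2
    then have "b = - l"
      using b \<open>l > 0\<close> by simp
    moreover have "- c = max (- l) (min l (- T))"
      unfolding c by (rule neg)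
    from right[OF 2 out' this, of "- b'" "- c'"] assms(5,6)
    have "(- b' - l) * (- S - l) + (- c' - - c) * (- T - - c) + (- b' - l) * (- c' - - c) / 2 \<le> 0"
      by simp
    ultimately show ?thesis
      by (simp add: algebra_simps add_divide_distrib diff_divide_distrib)
  next
    case 3
    then have "c = l"
      using c \<open>l > 0\<close> by simp
    moreover have "3 * l \<le> \<bar>T + S\<bar> \<or> 3 * l \<le> \<bar>2 * T - S\<bar> \<or> 3 * l \<le> \<bar>2 * S - T\<bar>"
      using out by linarith
    from right[OF 3 this b, of c' b'] assms(5,6)
    have "(c' - l) * (T - l) + (b' - b) * (S - b) + (c' - l) * (b' - b) / 2 \<le> 0"
      by simp
    ultimately show ?thesis
      by (simp add: algebra_simps add_divide_distrib diff_divide_distrib)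
  next
    case 4
    then have "c = - l"
      using c \<open>l > 0\<close> by simp
    moreover have b_neg: "- b = max (- l) (min l (- S))"
      unfolding b by (rule neg)
    have "3 * l \<le> \<bar>- T + - S\<bar> \<or> 3 * l \<le> \<bar>2 * - T - - S\<bar> \<or> 3 * l \<le> \<bar>2 * - S - - T\<bar>"
      using out by linarith
    from right[OF 4 this b_neg, of "- c'" "- b'"] assms(5,6)
    have "(- c' - l) * (- T - l) + (- b' - - b) * (- S - - b) + (- c' - l) * (- b' - - b) / 2 \<le> 0"
      by simp
    ultimately show ?thesis
      by (simp add: algebra_simps add_divide_distrib diff_divide_distrib)
  qed
qed

context sixty_degree_frame
begin

lemma sum_set_contact:
  assumes "l > 0"
  shows "sum_set (contact l) = {s. 3 * l \<le> \<bar>s \<bullet> (u + v)\<bar> \<or> 3 * l \<le> \<bar>s \<bullet> (2 *\<^sub>R u - v)\<bar>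
    \<or> 3 * l \<le> \<bar>s \<bullet> (2 *\<^sub>R v - u)\<bar>}" (is "_ = ?O")
proof
  show "sum_set (contact l) \<subseteq> ?O"
  proof
    fix s
    assume "s \<in> sum_set (contact l)"
    then obtain x b c where bc: "\<bar>b\<bar> \<le> l" "\<bar>c\<bar> \<le> l" and s: "s = x + b *\<^sub>R u + c *\<^sub>R v"
      and contact: "corner_max l u v x = cost x (b *\<^sub>R u) (c *\<^sub>R v)"
      by (auto simp: sum_set_def mem_contact_iff[OF assms])
    define P Q where "P = x \<bullet> u + c / 2" and "Q = x \<bullet> v + b / 2"
    have "(b' - b) * P + (c' - c) * Q + (b' - b) * (c' - c) / 2 \<le> 0"
      if "\<bar>b'\<bar> \<le> l" "\<bar>c'\<bar> \<le> l" for b' c'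
      using cost_le_corner_max[OF that, of x]
      unfolding contact cost_segments P_def Q_def
      by (simp add: algebra_simps add_divide_distrib diff_divide_distrib)
    from outside_if_square_maximum[OF assms bc this]
    show "s \<in> ?O"
      by (simp add: s P_def Q_def inner_simps frame_inner algebra_simps add_divide_distrib
          diff_divide_distrib)
  qed
next
  show "?O \<subseteq> sum_set (contact l)"
  proof
    fix s
    assume s: "s \<in> ?O"
    define b c where "b = max (- l) (min l (s \<bullet> u))" and "c = max (- l) (min l (s \<bullet> v))"
    define x where "x = s - b *\<^sub>R u - c *\<^sub>R v"
    have bc: "\<bar>b\<bar> \<le> l" "\<bar>c\<bar> \<le> l"
      using \<open>l > 0\<close> by (auto simp: b_def c_def)
    have out: "3 * l \<le> \<bar>s \<bullet> u + s \<bullet> v\<bar> \<or> 3 * l \<le> \<bar>2 * (s \<bullet> u) - s \<bullet> v\<bar>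
        \<or> 3 * l \<le> \<bar>2 * (s \<bullet> v) - s \<bullet> u\<bar>"
      using s by (simp add: inner_simps)
    obtain b' c' where bc': "\<bar>b'\<bar> \<le> l" "\<bar>c'\<bar> \<le> l"
      "corner_max l u v x = b' * (x \<bullet> u) + c' * (x \<bullet> v) + b' * c' / 2"
      using corner_max_attained[OF assms] .
    have "(b' - b) * (s \<bullet> u - b) + (c' - c) * (s \<bullet> v - c) + (b' - b) * (c' - c) / 2 \<le> 0"
      using square_maximum_if_outside[OF assms out b_def c_def bc'(1,2)] .
    then have "corner_max l u v x \<le> cost x (b *\<^sub>R u) (c *\<^sub>R v)"
      unfolding bc'(3) cost_segments
      by (simp add: x_def inner_simps frame_inner algebra_simps add_divide_distrib
          diff_divide_distrib)
    with cost_le_corner_max[OF bc, of x] have "(x, b *\<^sub>R u, c *\<^sub>R v) \<in> contact l"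
      using bc by (auto simp: mem_contact_iff[OF assms])
    moreover have "s = x + b *\<^sub>R u + c *\<^sub>R v"
      by (simp add: x_def)
    ultimately show "s \<in> sum_set (contact l)"
      unfolding sum_set_def by blast
  qed
qed

end

section \<open>Failure of maximality\<close>

lemma permutes_1_2_cases:
  assumes "\<sigma> permutes {1, 2 :: nat}"
  obtains "\<sigma> 1 = 1" "\<sigma> 2 = 2" | "\<sigma> 1 = 2" "\<sigma> 2 = 1"
proof -
  have "\<sigma> 1 \<in> {1, 2}" "\<sigma> 2 \<in> {1, 2}" "\<sigma> 1 \<noteq> \<sigma> 2"
    using assms permutes_in_image[OF assms] permutes_inj[OF assms] by (auto simp: inj_eq)
  then show ?thesis
    using that by auto
qed

text \<open>For two points with difference \<open>(x, y, z)\<close>, exchanging their first, second or third components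
  lowers the total cost by \<open>x \<bullet> (y + z)\<close>, \<open>y \<bullet> (x + z)\<close> or \<open>z \<bullet> (x + y)\<close>. On two elements, any other choice
  of permutations has the same effect as one of these exchanges, or none.\<close>

lemma c_monotone_insert_0:
  assumes mono: "c_monotone \<Gamma>"
    and pos: "\<And>x y z. (x, y, z) \<in> \<Gamma> \<Longrightarrow> 0 \<le> x \<bullet> (y + z) \<and> 0 \<le> y \<bullet> (x + z) \<and> 0 \<le> z \<bullet> (x + y)"
  shows "c_monotone (insert (0, 0, 0) \<Gamma>)"
  unfolding c_monotone_def
proof (intro allI impI)
  fix x1 x2 x3 :: "nat \<Rightarrow> plane" and \<sigma>1 \<sigma>2 \<sigma>3 :: "nat \<Rightarrow> nat"
  assume mem: "\<forall>j\<in>{1, 2}. (x1 j, x2 j, x3 j) \<in> insert (0, 0, 0) \<Gamma>"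
    and perm: "\<sigma>1 permutes {1, 2} \<and> \<sigma>2 permutes {1, 2} \<and> \<sigma>3 permutes {1, 2}"
  show "(\<Sum>j\<in>{1, 2}. cost (x1 (\<sigma>1 j)) (x2 (\<sigma>2 j)) (x3 (\<sigma>3 j)))
      \<le> (\<Sum>j\<in>{1, 2}. cost (x1 j) (x2 j) (x3 j))"
  proof (cases "\<forall>j\<in>{1, 2}. (x1 j, x2 j, x3 j) \<in> \<Gamma>")
    case True
    then show ?thesis
      using mono perm unfolding c_monotone_def by blast
  next
    case False
    then obtain i where i: "i \<in> {1, 2 :: nat}" "x1 i = 0" "x2 i = 0" "x3 i = 0"
      using mem by auto
    define k where "k = 3 - i"
    have k: "{1, 2} = {i, k}" "i \<noteq> k" "k \<in> {1, 2}"
      using i(1) by (auto simp: k_def)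
    have pos_k: "0 \<le> x1 k \<bullet> (x2 k + x3 k)" "0 \<le> x2 k \<bullet> (x1 k + x3 k)" "0 \<le> x3 k \<bullet> (x1 k + x2 k)"
      using mem k(3) pos[of "x1 k" "x2 k" "x3 k"] by auto
    have perm_cases: "\<sigma> i = i \<and> \<sigma> k = k \<or> \<sigma> i = k \<and> \<sigma> k = i" if "\<sigma> permutes {1, 2}" for \<sigma>
      by (rule permutes_1_2_cases[OF that]) (use i(1) in \<open>auto simp: k_def\<close>)
    show ?thesis
      unfolding k(1)
      using perm_cases[OF conjunct1[OF perm]] perm_cases[OF conjunct1[OF conjunct2[OF perm]]]
        perm_cases[OF conjunct2[OF conjunct2[OF perm]]] k(2) i(2-4) pos_k
      by (elim disjE) (simp_all add: cost_def inner_add_right inner_commute)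
  qed
qed

context sixty_degree_frame
begin

lemma contact_monotone_at_0:
  assumes "l > 0" "(x, y, z) \<in> contact l"
  shows "0 \<le> x \<bullet> (y + z) \<and> 0 \<le> y \<bullet> (x + z) \<and> 0 \<le> z \<bullet> (x + y)"
proof -
  obtain b c where bc: "\<bar>b\<bar> \<le> l" "\<bar>c\<bar> \<le> l" and yz: "y = b *\<^sub>R u" "z = c *\<^sub>R v"
    and contact: "corner_max l u v x = cost x y z"
    using assms mem_contact_iff by blast
  have "cost x (- y) (- z) \<le> cost x y z" "cost x (- y) z \<le> cost x y z" "cost x y (- z) \<le> cost x y z"
    using cost_le_corner_max[of "- b" l "- c" x] cost_le_corner_max[of "- b" l c x]
      cost_le_corner_max[of b l "- c" x] bc
    unfolding contact unfolding yz by simp_all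
  then show ?thesis
    by (simp add: cost_def inner_simps inner_commute)
qed

lemma not_maximally_c_monotone_contact:
  assumes "l > 0"
  shows "\<not> maximally_c_monotone (contact l)"
proof -
  have "(0, 0, 0) \<notin> contact l"
    using assms by (auto simp: contact_set_def corner_max_def segment_indicator_def max_def)
  then have "contact l \<subset> insert (0, 0, 0) (contact l)"
    by auto
  then show ?thesis
    using c_monotone_insert_0 contact_monotone_at_0[OF assms]
    unfolding maximally_c_monotone_def by blast
qed

end

theorem proposition1p10:
  fixes lam :: real and u v :: "real ^ 2"
  assumes "lam > 0"
    and "u = vector [1, 0]"
    and "v = vector [1 / 2, sqrt 3 / 2]"
  shows "\<exists>f\<in>\<A>. \<exists>g\<in>\<A>. \<exists>h\<in>\<A>.
           c_conjugate_triple f g h \<and>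
           sum_set (contact_set f g h) = UNIV - interior (hexagon u v lam) \<and>
           \<not> maximally_c_monotone (contact_set f g h)"
proof -
  interpret sixty_degree_frame u v
    by unfold_locales (simp_all add: assms(2,3) inner_vec_def sum_2 field_simps)
  interpret swapped: sixty_degree_frame v u
    by (rule swap)
  let ?f = "\<lambda>x. ereal (corner_max lam u v x)"
  let ?g = "segment_indicator lam u" and ?h = "segment_indicator lam v"
  have "?g = c_conj ?h ?f"
    using swapped.c_conj_corner_max[OF \<open>lam > 0\<close>]
    by (simp add: c_conj_commute[of ?h] corner_max_commute[of lam u v])
  then have "c_conjugate_triple ?f ?g ?h"
    using c_conj_segments[OF \<open>lam > 0\<close>] c_conj_corner_max[OF \<open>lam > 0\<close>]
    by (simp add: c_conjugate_triple_def)
  moreover have "sum_set (contact lam) = UNIV - interior (hexagon u v lam)"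
    unfolding sum_set_contact[OF \<open>lam > 0\<close>] interior_hexagon_eq[OF \<open>lam > 0\<close>]
    by (auto simp: not_less)
  ultimately show ?thesis
    using corner_max_in_A[OF \<open>lam > 0\<close>] segment_indicator_in_A
      not_maximally_c_monotone_contact[OF \<open>lam > 0\<close>] by blast
qed

end
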